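(* Let $m\ge 2$ be an integer and let $a_0\ge a_1\ge\cdots\ge a_{m-1}>0$ be real numbers. For every $r\in\{1,\dots,m\}$ and every circular arrangement $z=(z_0,\dots,z_{m-1})$ of $(a_0,\dots,a_{m-1})$, $$P_r(a^G)\ge P_r(z),$$ where $a^G$ is the greedy arrangement of $(a_0,\dots,a_{m-1})$.
   Context: A circular arrangement $z=(z_0,\dots,z_{m-1})$ of $(a_0,\dots,a_{m-1})$ is a permutation of these numbers (as a multiset), with indices of $z$ read modulo $m$. For such $z$ and $r\in\{1,\dots,m\}$, $$P_r(z)=\sum_{k=0}^{m-1}\prod_{j=0}^{r-1}z_{k+j},$$ with indices modulo $m$. The greedy (circular-symmetric) arrangement $a^G=(a^G_0,\dots,a^G_{m-1})$ is defined by $a^G_i=a_{2i}$ and $a^G_{m-1-i}=a_{2i+1}$ for $i=0,\dots,\lfloor m/2\rfloor-1$, together with $a^G_{\lfloor m/2\rfloor}=a_{m-1}$ when $m$ is odd. *)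

theory Defs
  imports Complex_Main "HOL-Library.Multiset"
begin

(* A finite sequence (z_0, ..., z_{m-1}) is a list of length m; z_i with i read modulo m
   is z ! (i mod length z). *)

definition circular_arrangement :: "real list \<Rightarrow> real list \<Rightarrow> bool" where
  "circular_arrangement a z \<longleftrightarrow> mset z = mset a"

definition P :: "nat \<Rightarrow> real list \<Rightarrow> real" where
  "P r z = (\<Sum>k<length z. \<Prod>j<r. z ! ((k + j) mod length z))"

(* The last branch is the rule a^G_{m-1-i} = a_{2i+1}, solved for the index on the left;
   the lemmas below restate the three rules in their original form. *)
definition greedy :: "real list \<Rightarrow> real list" where
  "greedy a = (let m = length a in
     map (\<lambda>i. if i < m div 2 then a ! (2 * i)
              else if odd m \<and> i = m div 2 then a ! (m - 1)
              else a ! (2 * (m - 1 - i) + 1)) [0..<m])"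

lemma length_greedy: "length (greedy a) = length a"
  by (simp add: greedy_def Let_def)

lemma greedy_left:
  assumes "i < length a div 2"
  shows "greedy a ! i = a ! (2 * i)"
  using assms by (simp add: greedy_def Let_def)

lemma greedy_right:
  assumes "i < length a div 2"
  shows "greedy a ! (length a - 1 - i) = a ! (2 * i + 1)"
proof -
  have "length a - 1 - i < length a" "\<not> length a - 1 - i < length a div 2"
    "\<not> (odd (length a) \<and> length a - 1 - i = length a div 2)"
    "length a - 1 - (length a - 1 - i) = i"
    using assms by presburger+
  then show ?thesis
    by (auto simp: greedy_def Let_def)
qed

lemma greedy_middle:
  assumes "odd (length a)"
  shows "greedy a ! (length a div 2) = a ! (length a - 1)"
proof -
  have "length a div 2 < length a" using assms by presburger
  then show ?thesis
    using assms by (simp add: greedy_def Let_def)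
qed

end

theory Submission
  imports Defs "HOL-Combinatorics.Permutations"
begin

text \<open>
  The proof is by two-point symmetrization. Given a reflection of the circle, call one of the two
  sides of its axis the far side and, in every pair of mirror images, move the smaller value
  there. A window and its mirror image differ only in positions on a single side of the axis, so
  the sum of their two products does not decrease. Pairing the windows with their mirror images
  shows that polarization does not decrease \<open>P r\<close>.

  Rank the positions as \<open>0, m - 1, 1, m - 2, \<dots>\<close>. The reflections \<open>i \<mapsto> m - 1 - i\<close> and \<open>i \<mapsto> - i\<close>
  exchange neighbouring ranks, so an arrangement that both polarizations fix decreases along the
  ranks and hence is the greedy one. Such an arrangement is found by minimizing the rank-weighted
  sum of the values among all arrangements \<open>y\<close> with \<open>P r y \<ge> P r z\<close>.
\<close>

section \<open>Reflections of the circle\<close>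

definition reflect :: "int \<Rightarrow> int \<Rightarrow> int \<Rightarrow> int" where
  "reflect m c i = (c - i) mod m"

text \<open>The axis of \<open>reflect m c\<close> passes through \<open>c / 2\<close> and \<open>(c + m) / 2\<close>; doubling keeps this
  integral.\<close>

definition far :: "int \<Rightarrow> int \<Rightarrow> int \<Rightarrow> bool" where
  "far m c i \<longleftrightarrow> 0 < (2 * i - c) mod (2 * m) \<and> (2 * i - c) mod (2 * m) < m"

text \<open>Points on the axis are not far, but there \<open>min\<close> and \<open>max\<close>
  agree. Replacing \<open>c\<close> by \<open>c + m\<close> keeps the reflection and exchanges its
  two sides.\<close>

definition polarize :: "int \<Rightarrow> int \<Rightarrow> (int \<Rightarrow> real) \<Rightarrow> int \<Rightarrow> real" where
  "polarize m c f i =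
     (if far m c i then min (f i) (f (reflect m c i)) else max (f i) (f (reflect m c i)))"

lemma reflect_in: "m > 0 \<Longrightarrow> reflect m c i \<in> {0..<m}"
  by (simp add: reflect_def)

lemma reflect_reflect: "i \<in> {0..<m} \<Longrightarrow> reflect m c (reflect m c i) = i"
  by (simp add: reflect_def mod_diff_right_eq)

lemma reflect_mod: "reflect m c (i mod m) = reflect m c i"
  by (simp add: reflect_def mod_diff_right_eq)

lemma bij_betw_reflect: "m > 0 \<Longrightarrow> bij_betw (reflect m c) {0..<m} {0..<m}"
  by (rule bij_betw_byWitness[where f' = "reflect m c"])
     (simp_all add: reflect_reflect reflect_in image_subset_iff del: atLeastLessThan_iff)

text \<open>Shifting \<open>i\<close> by \<open>m\<close> shifts \<open>2 * i - c\<close> by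
  \<open>2 * m\<close>, which is why sides are read off modulo \<open>2 * m\<close>.\<close>

lemma far_mod: "far m c (i mod m) \<longleftrightarrow> far m c i"
proof -
  have "2 * s - c = 2 * i - c + 2 * m * (- q)" if "m * q + s = i" for q s
    using that by (auto simp: algebra_simps)
  from this[OF mult_div_mod_eq]
  have "(2 * (i mod m) - c) mod (2 * m) = (2 * i - c) mod (2 * m)"
    by (metis mod_mult_self2)
  then show ?thesis by (simp add: far_def)
qed

text \<open>Reflection negates \<open>2 * i - c\<close> modulo \<open>2 * m\<close>. This exchanges
  the residues strictly between \<open>0\<close> and \<open>m\<close> with those above
  \<open>m\<close>; the residues \<open>0\<close> and \<open>m\<close> are the fixed points.\<close>

lemma far_reflect:
  assumes "i \<in> {0..<m}"
  shows "far m c (reflect m c i) \<longleftrightarrow> \<not> far m c i \<and> reflect m c i \<noteq> i"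
proof -
  have m: "m > 0" using assms by simp
  define u where "u = 2 * i - c"
  have "far m c (reflect m c i) \<longleftrightarrow> 0 < (- u) mod (2 * m) \<and> (- u) mod (2 * m) < m"
    unfolding reflect_def far_mod by (simp add: far_def u_def algebra_simps)
  moreover have "(- u) mod (2 * m) = (if u mod (2 * m) = 0 then 0 else 2 * m - u mod (2 * m))"
    by (rule zmod_zminus1_eq_if)
  moreover have "0 \<le> u mod (2 * m)" "u mod (2 * m) < 2 * m"
    using m by simp_all
  moreover have "reflect m c i = i \<longleftrightarrow> u mod (2 * m) = 0 \<or> u mod (2 * m) = m"
  proof -
    have "reflect m c i = i \<longleftrightarrow> (c - i) mod m = i mod m"
      using assms by (simp add: reflect_def)
    also have "\<dots> \<longleftrightarrow> m dvd u"
      using dvd_diff_commute[of m c "2 * i"] by (simp add: u_def mod_eq_dvd_iff algebra_simps)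
    also have "\<dots> \<longleftrightarrow> m dvd u mod (2 * m)"
      by (rule dvd_mod_iff[symmetric]) simp
    also have "\<dots> \<longleftrightarrow> u mod (2 * m) = 0 \<or> u mod (2 * m) = m"
    proof
      assume "m dvd u mod (2 * m)"
      then obtain q where q: "u mod (2 * m) = m * q" ..
      have "0 \<le> m * q" "m * q < m * 2"
        using m q[symmetric] by (simp_all add: mult.commute)
      then have "0 \<le> q" "q < 2"
        using m by (simp_all add: zero_le_mult_iff)
      then have "q = 0 \<or> q = 1" by auto
      then show "u mod (2 * m) = 0 \<or> u mod (2 * m) = m" using q by auto
    qed auto
    finally show ?thesis .
  qed
  ultimately show ?thesis
    unfolding far_def u_def[symmetric] by auto
qed

lemma polarize_reflect:
  assumes "i \<in> {0..<m}"
  shows "polarize m c f (reflect m c i) =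
    (if far m c i then max (f i) (f (reflect m c i)) else min (f i) (f (reflect m c i)))"
proof (cases "reflect m c i = i")
  case True
  then show ?thesis by (simp add: polarize_def)
next
  case False
  then show ?thesis
    using assms far_reflect[OF assms, of c] by (auto simp: polarize_def reflect_reflect max.commute min.commute)
qed

section \<open>Polarization does not decrease the sum over the windows\<close>

text \<open>A set of positions, so that a window can be intersected with its mirror image.\<close>

definition window :: "int \<Rightarrow> int \<Rightarrow> int \<Rightarrow> int set" where
  "window m r k = (\<lambda>j. (k + j) mod m) ` {0..<r}"

lemma window_memI: "k \<le> x \<Longrightarrow> x < k + r \<Longrightarrow> x mod m \<in> window m r k"
  unfolding window_def by (rule image_eqI[where x = "x - k"]) auto

lemma window_memE:
  assumes "x \<in> window m r k"
  obtains X where "k \<le> X" "X < k + r" "x = X mod m"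
proof -
  obtain j where "j \<in> {0..<r}" "x = (k + j) mod m"
    using assms by (auto simp: window_def)
  then show thesis by (intro that[of "k + j"]) auto
qed

lemma window_subset: "m > 0 \<Longrightarrow> window m r k \<subseteq> {0..<m}"
  by (auto simp: window_def)

text \<open>A reflection reverses the window, so the image starts at the mirror image of the last
  position \<open>k + r - 1\<close>.\<close>

lemma reflect_window:
  "reflect m c ` window m r k = window m r (reflect m (c - r + 1) k)"
proof -
  have "reflect m c ` window m r k = (\<lambda>j. (c - (k + j)) mod m) ` {0..<r}"
    by (simp add: window_def image_image reflect_def mod_diff_right_eq)
  also have "\<dots> = (\<lambda>j. (c - (k + (r - 1 - j))) mod m) ` {0..<r}"
  proof -
    have "(\<lambda>j. r - 1 - j) ` {0..<r} = {0..<r}"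
      by (auto intro: image_eqI[where x = "r - 1 - j" for j])
    then show ?thesis
      by (metis (no_types, lifting) image_cong image_image)
  qed
  also have "\<dots> = window m r (reflect m (c - r + 1) k)"
    unfolding window_def reflect_def mod_add_left_eq by (simp add: algebra_simps)
  finally show ?thesis .
qed

text \<open>If \<open>x\<close> and \<open>y\<close> were on opposite sides, an end of the axis
  would lie strictly between their lifts to the integer interval from \<open>k\<close> to
  \<open>k + r - 1\<close>. The lift nearer to that end would then have its mirror image inside the
  window.\<close>

lemma window_diff_one_side:
  assumes m: "0 < m" and r: "r \<le> m"
    and x: "x \<in> window m r k" "reflect m c x \<notin> window m r k"
    and y: "y \<in> window m r k" "reflect m c y \<notin> window m r k"
    and "far m c x"
  shows "far m c y"
proof (rule ccontr)
  assume nf: "\<not> far m c y"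
  obtain X where X: "k \<le> X" "X < k + r" "x = X mod m"
    using x(1) by (rule window_memE)
  obtain Y where Y: "k \<le> Y" "Y < k + r" "y = Y mod m"
    using y(1) by (rule window_memE)
  have yI: "y \<in> {0..<m}" using window_subset[OF m] y(1) by blast
  have "reflect m c y \<noteq> y" using y by auto
  then have "far m c (reflect m c y)"
    using far_reflect[OF yI] nf by blast
  \<comment> \<open>The mirror image is used unreduced, so that its doubled coordinate is exactly
    \<open>c - 2 * Y\<close>.\<close>
  then have "far m c (c - Y)"
    by (simp add: Y(3) reflect_mod) (simp add: reflect_def far_mod)
  then have V: "0 < (c - 2 * Y) mod (2 * m)" "(c - 2 * Y) mod (2 * m) < m"
    by (simp_all add: far_def algebra_simps)
  have "far m c X" using \<open>far m c x\<close> by (simp add: X(3) far_mod)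
  then have U: "0 < (2 * X - c) mod (2 * m)" "(2 * X - c) mod (2 * m) < m"
    by (simp_all add: far_def)
  define p where "p = (2 * X - c) div (2 * m)"
  define q where "q = (c - 2 * Y) div (2 * m)"
  define M where "M = m * (p + q)"
  have eU: "2 * X - c = 2 * m * p + (2 * X - c) mod (2 * m)"
    unfolding p_def by simp
  have eV: "c - 2 * Y = 2 * m * q + (c - 2 * Y) mod (2 * m)"
    unfolding q_def by simp
  \<comment> \<open>No lift of the mirror image lies in the interval; \<open>t\<close> selects the
    lift, and below the end of the axis about which it is taken.\<close>
  have refl: "\<not> (k \<le> c - Z + m * t \<and> c - Z + m * t < k + r)"
    if "reflect m c (Z mod m) \<notin> window m r k" for Z t
    using that window_memI[of k "c - Z + m * t" r m] by (auto simp: reflect_mod) (auto simp: reflect_def)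
  have "2 * (X - Y) = 2 * m * (p + q) + (2 * X - c) mod (2 * m) + (c - 2 * Y) mod (2 * m)"
    using eU eV by (simp add: algebra_simps)
  then have XY: "2 * m * (p + q) < 2 * (X - Y)" "2 * (X - Y) < 2 * m * (p + q) + 2 * m"
    using U V by linarith+
  have "X - Y < m" "- m < X - Y" using X Y r by linarith+
  then have "m * (p + q) < m * 1" "m * (- 2) < m * (p + q)"
    using XY by (simp_all add: algebra_simps)
  then have "p + q < 1" "- 2 < p + q" using m by (simp_all only: mult_less_cancel_left_pos)
  then have "p + q = 0 \<or> p + q = - 1" by linarith
  then show False
  proof
    \<comment> \<open>The separating end is \<open>c / 2 + m * p\<close>, with \<open>Y\<close>
      before it and \<open>X\<close> after it.\<close>
    assume "p + q = 0"
    then have q: "q = - p" by simp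
    have "Y < X" using XY \<open>p + q = 0\<close> by simp
    have "2 * m * p < 2 * X - c" "2 * m * p > 2 * Y - c" using eU eV U V q by auto
    then show False
      using refl[of X "2 * p"] refl[of Y "2 * p"] x(2) y(2) X Y by (simp add: algebra_simps)
  next
    \<comment> \<open>The separating end is \<open>c / 2 + m * p + m / 2\<close>, now with
      \<open>X\<close> before it and \<open>Y\<close> after it.\<close>
    assume "p + q = - 1"
    then have q: "q = - p - 1" by simp
    have "2 * X - c < 2 * m * p + m" "2 * Y - c > 2 * m * p + m"
      using eU eV U V q by (auto simp: algebra_simps)
    then show False
      using refl[of X "2 * p + 1"] refl[of Y "2 * p + 1"] x(2) y(2) X Y by (simp add: algebra_simps)
  qed
qed

text \<open>Both pairs of products have the same product, and the product of the maxima dominates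
  \<open>prod f A\<close> and \<open>prod g A\<close>. For a fixed product, the pair with the larger
  maximum has the larger sum.\<close>

lemma prod_add_prod_le_max_min:
  fixes f g :: "'a \<Rightarrow> 'b :: linordered_field"
  assumes "\<And>i. i \<in> A \<Longrightarrow> 0 < f i" "\<And>i. i \<in> A \<Longrightarrow> 0 < g i"
  shows "prod f A + prod g A \<le> (\<Prod>i\<in>A. max (f i) (g i)) + (\<Prod>i\<in>A. min (f i) (g i))"
proof -
  let ?M = "\<Prod>i\<in>A. max (f i) (g i)" and ?N = "\<Prod>i\<in>A. min (f i) (g i)"
  have eq: "?M * ?N = prod f A * prod g A"
    unfolding prod.distrib[symmetric] by (intro prod.cong) (auto simp: max_def min_def)
  have "prod f A \<le> ?M" "prod g A \<le> ?M"
    using assms by (auto intro!: prod_mono intro: less_imp_le)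
  then have "0 \<le> (?M - prod f A) * (?M - prod g A)" by simp
  then have "?M * (prod f A + prod g A) \<le> ?M * (?M + ?N)"
    using eq by (simp add: algebra_simps)
  moreover have "0 < ?M"
    using assms by (intro prod_pos) (auto simp: less_max_iff_disj)
  ultimately show ?thesis by simp
qed

text \<open>\<open>I\<close> consists of whole mirror pairs and points on the axis, and polarization
  only rearranges the values within each of them.\<close>

lemma prod_polarize_invariant:
  assumes "m > 0" and I: "I \<subseteq> {0..<m}" "reflect m c ` I = I"
    and pos: "\<And>i. i \<in> {0..<m} \<Longrightarrow> 0 < f i"
  shows "prod (polarize m c f) I = prod f I"
proof -
  \<comment> \<open>Comparing squares avoids choosing representatives of the mirror pairs.\<close>
  have inj: "inj_on (reflect m c) I"
    using bij_betw_reflect[OF \<open>m > 0\<close>] I(1) by (meson bij_betw_imp_inj_on inj_on_subset)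
  have sq: "(prod h I)\<^sup>2 = (\<Prod>i\<in>I. h i * h (reflect m c i))" for h :: "int \<Rightarrow> real"
  proof -
    have "prod h I = (\<Prod>i\<in>I. h (reflect m c i))"
      using prod.reindex[OF inj, of h] I(2) by simp
    then show ?thesis by (simp add: power2_eq_square prod.distrib)
  qed
  have "(prod (polarize m c f) I)\<^sup>2 = (prod f I)\<^sup>2"
    unfolding sq
  proof (intro prod.cong refl)
    fix i assume "i \<in> I"
    then have "i \<in> {0..<m}" using I(1) by blast
    from polarize_reflect[OF this, of c f]
    show "polarize m c f i * polarize m c f (reflect m c i) = f i * f (reflect m c i)"
      by (auto simp: polarize_def max_def min_def)
  qed
  moreover have "0 < polarize m c f i" if "i \<in> {0..<m}" for i
    using pos[OF that] pos[OF reflect_in[OF \<open>m > 0\<close>]]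
    by (simp add: polarize_def less_max_iff_disj)
  then have "0 < prod (polarize m c f) I" "0 < prod f I"
    using pos I(1) by (meson prod_pos subsetD)+
  ultimately show ?thesis by simp
qed

text \<open>The overlap of the window with its mirror image contributes a common factor that
  polarization preserves. The rest of the window lies on one side, so polarization collects all
  maxima in one of the two remaining products and all minima in the other.\<close>

lemma prod_window_polarize:
  fixes m r k c :: int and f :: "int \<Rightarrow> real"
  assumes m: "0 < m" and r: "r \<le> m"
    and pos: "\<And>i. i \<in> {0..<m} \<Longrightarrow> 0 < f i"
  defines "W \<equiv> window m r k" and "\<rho> \<equiv> reflect m c" and "g \<equiv> polarize m c f"
  shows "prod f W + prod f (\<rho> ` W) \<le> prod g W + prod g (\<rho> ` W)"
proof -
  have W: "W \<subseteq> {0..<m}" using window_subset[OF m] by (simp add: W_def)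
  have fin: "finite W" by (simp add: W_def window_def)
  have rr: "\<rho> (\<rho> i) = i" if "i \<in> W" for i
    using that W by (auto simp: \<rho>_def reflect_reflect)
  have rI: "\<rho> i \<in> {0..<m}" for i by (simp only: \<rho>_def reflect_in[OF m])
  have rW: "i \<in> \<rho> ` W \<longleftrightarrow> \<rho> i \<in> W" if "i \<in> {0..<m}" for i
    using that rr by (metis \<rho>_def image_iff reflect_reflect)
  define I where "I = W \<inter> \<rho> ` W"
  define D where "D = W - \<rho> ` W"
  have rhoI: "\<rho> ` I = I" 
  proof -
    have sub: "\<rho> ` I \<subseteq> I" using rr by (auto simp: I_def)
    moreover have "I \<subseteq> \<rho> ` I"
    proof
      fix i assume i: "i \<in> I"
      then have "\<rho> i \<in> I" "\<rho> (\<rho> i) = i" using sub rr by (auto simp: I_def)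
      then show "i \<in> \<rho> ` I" by (metis imageI)
    qed
    ultimately show ?thesis by blast
  qed
  have W_eq: "W = I \<union> D" "I \<inter> D = {}" by (auto simp: I_def D_def)
  have inj: "inj_on \<rho> W" using rr by (metis inj_onI)
  have rW_eq: "\<rho> ` W = I \<union> \<rho> ` D" "I \<inter> \<rho> ` D = {}"
  proof -
    show "\<rho> ` W = I \<union> \<rho> ` D" using W_eq rhoI by (metis image_Un)
    have "\<rho> i \<notin> W" if "i \<in> D" for i
      using that rr by (metis D_def DiffE imageI)
    then show "I \<inter> \<rho> ` D = {}" by (auto simp: I_def)
  qed
  have finI: "finite I" "finite D" using fin by (simp_all add: I_def D_def)
  have injD: "inj_on \<rho> D" using inj by (rule inj_on_subset) (simp add: D_def)
  have split: "prod h W + prod h (\<rho> ` W) = prod h I * (prod h D + (\<Prod>i\<in>D. h (\<rho> i)))"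
    for h :: "int \<Rightarrow> real"
  proof -
    have "prod h W = prod h I * prod h D"
      using prod.union_disjoint[OF finI W_eq(2), of h] W_eq(1) by simp
    moreover have "prod h (\<rho> ` W) = prod h I * prod h (\<rho> ` D)"
      using prod.union_disjoint[of I "\<rho> ` D" h] finI rW_eq by simp
    moreover have "prod h (\<rho> ` D) = (\<Prod>i\<in>D. h (\<rho> i))"
      using prod.reindex[OF injD, of h] by simp
    ultimately show ?thesis by (simp add: algebra_simps)
  qed
  have DI: "i \<in> {0..<m}" if "i \<in> D" for i using that W by (auto simp: D_def)
  have one_side: "far m c i \<longleftrightarrow> far m c j" if "i \<in> D" "j \<in> D" for i j
    using that window_diff_one_side[OF m r, of _ k c] rW DI unfolding D_def W_def \<rho>_def by blast
  have prod_D: "(\<Prod>i\<in>D. max (f i) (f (\<rho> i))) + (\<Prod>i\<in>D. min (f i) (f (\<rho> i))) =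
      prod g D + (\<Prod>i\<in>D. g (\<rho> i))"
  proof (cases "\<exists>i\<in>D. far m c i")
    case True
    then have "far m c i" if "i \<in> D" for i using that one_side by blast
    then have "prod g D = (\<Prod>i\<in>D. min (f i) (f (\<rho> i)))"
      "(\<Prod>i\<in>D. g (\<rho> i)) = (\<Prod>i\<in>D. max (f i) (f (\<rho> i)))"
      using polarize_reflect[OF DI, of _ c f]
      by (auto intro!: prod.cong simp: g_def \<rho>_def polarize_def[of m c f i for i])
    then show ?thesis by simp
  next
    case False
    then have "prod g D = (\<Prod>i\<in>D. max (f i) (f (\<rho> i)))"
      "(\<Prod>i\<in>D. g (\<rho> i)) = (\<Prod>i\<in>D. min (f i) (f (\<rho> i)))"
      using polarize_reflect[OF DI, of _ c f]
      by (auto intro!: prod.cong simp: g_def \<rho>_def polarize_def[of m c f i for i])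
    then show ?thesis by simp
  qed
  have "prod f D + (\<Prod>i\<in>D. f (\<rho> i)) \<le> prod g D + (\<Prod>i\<in>D. g (\<rho> i))"
    unfolding prod_D[symmetric] by (rule prod_add_prod_le_max_min) (auto intro!: pos DI rI)
  moreover have "0 \<le> prod f I"
    using pos W by (intro prod_nonneg less_imp_le) (auto simp: I_def)
  moreover have "prod g I = prod f I"
    unfolding g_def using W rhoI by (intro prod_polarize_invariant[OF m _ _ pos]) (auto simp: I_def \<rho>_def)
  ultimately show ?thesis
    unfolding split by (simp add: mult_left_mono)
qed

lemma sum_window_polarize:
  assumes m: "0 < m" and r: "r \<le> m"
    and pos: "\<And>i. i \<in> {0..<m} \<Longrightarrow> 0 < f i"
  shows "(\<Sum>k\<in>{0..<m}. prod f (window m r k)) \<le>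
    (\<Sum>k\<in>{0..<m}. prod (polarize m c f) (window m r k))"
proof -
  \<comment> \<open>Mirroring windows permutes their starting points, by the reflection with
    parameter \<open>c - r + 1\<close>.\<close>
  have double: "2 * (\<Sum>k\<in>{0..<m}. prod h (window m r k)) =
    (\<Sum>k\<in>{0..<m}. prod h (window m r k) + prod h (reflect m c ` window m r k))"
    for h :: "int \<Rightarrow> real"
    using sum.reindex_bij_betw[OF bij_betw_reflect[OF m, of "c - r + 1"],
        of "\<lambda>k. prod h (window m r k)"]
    by (simp add: sum.distrib reflect_window)
  have "2 * (\<Sum>k\<in>{0..<m}. prod f (window m r k)) \<le>
      2 * (\<Sum>k\<in>{0..<m}. prod (polarize m c f) (window m r k))"
    unfolding double by (intro sum_mono prod_window_polarize[OF m r pos])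
  then show ?thesis by simp
qed

section \<open>Polarization of arrangements\<close>

definition polarize_list :: "int \<Rightarrow> real list \<Rightarrow> real list" where
  "polarize_list c z =
     map (\<lambda>i. polarize (int (length z)) c (\<lambda>i. z ! nat i) (int i)) [0..<length z]"

lemma length_polarize_list: "length (polarize_list c z) = length z"
  by (simp add: polarize_list_def)

lemma nth_polarize_list:
  "i \<in> {0..<int (length z)} \<Longrightarrow>
    polarize_list c z ! nat i = polarize (int (length z)) c (\<lambda>i. z ! nat i) i"
  by (simp add: polarize_list_def nat_less_iff)

lemma mset_polarize_list: "mset (polarize_list c z) = mset z"
proof (cases "z = []")
  case True
  then show ?thesis by (simp add: polarize_list_def)
next
  case False
  define m where "m = int (length z)"
  have m: "m > 0" using False by (simp add: m_def)
  define f where "f = (\<lambda>i. z ! nat i)"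
  \<comment> \<open>Exchanges exactly those mirror pairs whose values polarization exchanges, hence
    is an involution.\<close>
  define \<tau> where "\<tau> i = (if polarize m c f i = f i then i else reflect m c i)" for i
  have in_m: "\<tau> i \<in> {0..<m}" if "i \<in> {0..<m}" for i
    using that reflect_in[OF m] by (simp add: \<tau>_def)
  have f\<tau>: "f (\<tau> i) = polarize m c f i" for i
    by (auto simp: \<tau>_def polarize_def max_def min_def)
  have inv: "\<tau> (\<tau> i) = i" if "i \<in> {0..<m}" for i
    using polarize_reflect[OF that, of c f] that
    by (auto simp: \<tau>_def polarize_def reflect_reflect max_def min_def split: if_splits)
  \<comment> \<open>\<open>permutes\<close> demands the identity outside the index range.\<close>
  define \<pi> where "\<pi> i = (if i < length z then nat (\<tau> (int i)) else i)" for i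
  have lt: "\<pi> i < length z" if "i < length z" for i
    using in_m[of "int i"] that by (auto simp: \<pi>_def m_def)
  have inv': "\<pi> (\<pi> i) = i" for i
    using lt[of i] in_m[of "int i"] inv[of "int i"] by (auto simp: \<pi>_def m_def)
  have "bij_betw \<pi> {..<length z} {..<length z}"
    by (rule bij_betw_byWitness[where f' = \<pi>]) (auto simp: inv' lt)
  then have "\<pi> permutes {..<length z}"
    by (rule bij_imp_permutes) (simp add: \<pi>_def)
  moreover have "polarize_list c z = permute_list \<pi> z"
    using f\<tau> by (auto simp: polarize_list_def permute_list_def \<pi>_def m_def f_def)
  ultimately show ?thesis by simp
qed

lemma P_eq_sum_window:
  assumes "z \<noteq> []" "r \<le> length z"
  shows "P r z = (\<Sum>k\<in>{0..<int (length z)}.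
    prod (\<lambda>i. z ! nat i) (window (int (length z)) (int r) k))"
  unfolding P_def
proof (rule sum.reindex_bij_witness[of _ nat int])
  fix k assume k: "k \<in> {..<length z}"
  let ?m = "int (length z)"
  \<comment> \<open>Since \<open>r\<close> is at most the length, the positions of a window are
    distinct and the product over the set repeats no factor.\<close>
  have "inj_on (\<lambda>j. (int k + j) mod ?m) {0..<int r}"
  proof (rule inj_onI)
    fix i j assume ij: "i \<in> {0..<int r}" "j \<in> {0..<int r}"
      and "(int k + i) mod ?m = (int k + j) mod ?m"
    then have "i mod ?m = j mod ?m"
      by (metis add_diff_cancel_left' mod_diff_left_eq)
    then show "i = j" using ij assms by simp
  qed
  then have "prod (\<lambda>i. z ! nat i) (window ?m (int r) (int k)) =
      (\<Prod>j\<in>{0..<int r}. z ! nat ((int k + j) mod ?m))"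
    by (simp add: window_def prod.reindex)
  also have "\<dots> = (\<Prod>j<r. z ! ((k + j) mod length z))"
    by (rule prod.reindex_bij_witness[of _ int nat])
       (auto simp: nat_mod_distrib nat_add_distrib)
  finally show "prod (\<lambda>i. z ! nat i) (window ?m (int r) (int k)) =
    (\<Prod>j<r. z ! ((k + j) mod length z))" .
qed auto

lemma P_polarize_list:
  assumes "z \<noteq> []" "r \<le> length z" "\<forall>x\<in>set z. 0 < x"
  shows "P r z \<le> P r (polarize_list c z)"
proof -
  let ?m = "int (length z)"
  have m: "?m > 0" using assms(1) by simp
  have ne: "polarize_list c z \<noteq> []"
    using assms(1) length_polarize_list[of c z] by (metis length_0_conv)
  have "P r z \<le> (\<Sum>k\<in>{0..<?m}. prod (polarize ?m c (\<lambda>i. z ! nat i)) (window ?m (int r) k))"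
    unfolding P_eq_sum_window[OF assms(1,2)]
    using assms by (intro sum_window_polarize) auto
  also have "\<dots> = P r (polarize_list c z)"
    using window_subset[OF m] assms(2) ne
    by (subst P_eq_sum_window) (auto simp: length_polarize_list intro!: sum.cong prod.cong
        nth_polarize_list[symmetric])
  finally show ?thesis .
qed

text \<open>The rearrangement inequality in each mirror pair: the far side has the larger weight and
  receives the smaller value. The pair of \<open>i\<close> is strictly out of order, which makes the
  descent strict.\<close>

lemma sum_polarize_less:
  fixes w :: "int \<Rightarrow> real"
  assumes m: "0 < m"
    and w: "\<And>i. i \<in> {0..<m} \<Longrightarrow> \<not> far m c i \<Longrightarrow> w i \<le> w (reflect m c i)"
    and i: "i \<in> {0..<m}" "w i < w (reflect m c i)" "f i < f (reflect m c i)"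
  shows "(\<Sum>i\<in>{0..<m}. w i * polarize m c f i) < (\<Sum>i\<in>{0..<m}. w i * f i)"
proof -
  let ?\<rho> = "reflect m c" and ?g = "polarize m c f"
  have double: "2 * (\<Sum>i\<in>{0..<m}. w i * h i) =
    (\<Sum>i\<in>{0..<m}. w i * h i + w (?\<rho> i) * h (?\<rho> i))" for h :: "int \<Rightarrow> real"
    using sum.reindex_bij_betw[OF bij_betw_reflect[OF m, of c], of "\<lambda>i. w i * h i"]
    by (simp add: sum.distrib)
  have w': "w (?\<rho> j) \<le> w j" if "j \<in> {0..<m}" "far m c j" for j
    using w[of "?\<rho> j"] that far_reflect[OF that(1), of c] reflect_in[OF m, of c j]
    by (simp add: reflect_reflect)
  have rearr: "a * y + b * x \<le> a * x + b * y" if "a \<le> b" "x \<le> y" for a b x y :: real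
    using mult_nonneg_nonneg[of "b - a" "y - x"] that by (simp add: algebra_simps)
  have "(\<Sum>i\<in>{0..<m}. w i * ?g i + w (?\<rho> i) * ?g (?\<rho> i)) <
      (\<Sum>i\<in>{0..<m}. w i * f i + w (?\<rho> i) * f (?\<rho> i))"
  proof (rule sum_strict_mono_ex1, simp, intro ballI)
    fix j assume j: "j \<in> {0..<m}"
    show "w j * ?g j + w (?\<rho> j) * ?g (?\<rho> j) \<le> w j * f j + w (?\<rho> j) * f (?\<rho> j)"
    proof (cases "far m c j")
      case True
      then show ?thesis
        using rearr[OF w'[OF j True], of "f (?\<rho> j)" "f j"]
        by (simp add: polarize_reflect[OF j] polarize_def[of m c f j] max_def min_def algebra_simps)
    next
      case False
      then show ?thesis
        using rearr[OF w[OF j False], of "f j" "f (?\<rho> j)"]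
        by (simp add: polarize_reflect[OF j] polarize_def[of m c f j] max_def min_def algebra_simps)
    qed
  next
    have "\<not> far m c i" using w'[OF i(1)] i(2) by auto
    then have "?g i = f (?\<rho> i)" "?g (?\<rho> i) = f i"
      using polarize_reflect[OF i(1), of c f] i(3) by (simp_all add: polarize_def)
    moreover have "0 < (w (?\<rho> i) - w i) * (f (?\<rho> i) - f i)" using i by simp
    ultimately have "w i * ?g i + w (?\<rho> i) * ?g (?\<rho> i) < w i * f i + w (?\<rho> i) * f (?\<rho> i)"
      by (simp add: algebra_simps)
    then show "\<exists>i\<in>{0..<m}. w i * ?g i + w (?\<rho> i) * ?g (?\<rho> i) < w i * f i + w (?\<rho> i) * f (?\<rho> i)"
      using i(1) by blast
  qed
  then show ?thesis by (simp add: double[symmetric])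
qed

section \<open>The greedy arrangement\<close>

text \<open>The index in \<open>a\<close> of the entry that the greedy arrangement puts at position
  \<open>i\<close>; \<open>position m\<close> is the inverse on \<open>{..<m}\<close>.\<close>

definition rank :: "nat \<Rightarrow> nat \<Rightarrow> nat" where
  "rank m i = (if 2 * i < m then 2 * i else 2 * (m - 1 - i) + 1)"

definition position :: "nat \<Rightarrow> nat \<Rightarrow> nat" where
  "position m t = (if even t then t div 2 else m - 1 - t div 2)"

lemma position_less: "t < m \<Longrightarrow> position m t < m"
  by (auto simp: position_def)

lemma rank_less: "i < m \<Longrightarrow> rank m i < m"
  unfolding rank_def by auto

lemma position_rank: "i < m \<Longrightarrow> position m (rank m i) = i"
  unfolding position_def rank_def by auto

lemma rank_position: "t < m \<Longrightarrow> rank m (position m t) = t"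
  by (cases "even t") (auto simp: position_def rank_def elim!: evenE oddE)

lemma greedy_nth:
  assumes "i < length a"
  shows "greedy a ! i = a ! rank (length a) i"
proof -
  \<comment> \<open>The middle branch of \<open>greedy\<close> thus agrees with the even-index rule,
    so \<open>rank\<close> has only two cases.\<close>
  have "2 * i = length a - 1" if "odd (length a)" "i = length a div 2"
    using that by presburger
  then show ?thesis
    using assms by (auto simp: greedy_def rank_def Let_def)
qed

lemma sorted_wrt_ge_mset_unique:
  fixes xs ys :: "'a :: linorder list"
  assumes "sorted_wrt (\<ge>) xs" "sorted_wrt (\<ge>) ys" "mset xs = mset ys"
  shows "xs = ys"
proof -
  have "sorted (rev xs)" "sorted (rev ys)"
    using assms(1,2) by (simp_all add: sorted_wrt_rev)
  then have "rev xs = rev ys"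
    using assms(3) by (metis mset_rev properties_for_sort)
  then show ?thesis by simp
qed

text \<open>Read in the order of the ranks, \<open>y\<close> is a decreasing list with the multiset
  of \<open>a\<close>, hence \<open>a\<close> itself.\<close>

lemma greedy_unique:
  assumes a: "sorted_wrt (\<ge>) a" and y: "mset y = mset a"
    and step: "\<And>t. Suc t < length a \<Longrightarrow>
      y ! position (length a) (Suc t) \<le> y ! position (length a) t"
  shows "y = greedy a"
proof -
  define m where "m = length a"
  have len: "length y = m" using y by (metis m_def size_mset)
  define \<pi> where "\<pi> t = (if t < m then position m t else t)" for t
  have "bij_betw \<pi> {..<m} {..<m}"
    by (rule bij_betw_byWitness[where f' = "rank m"])
       (auto simp: \<pi>_def position_rank rank_position position_less rank_less)
  then have "\<pi> permutes {..<length y}"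
    unfolding len by (rule bij_imp_permutes) (simp add: \<pi>_def)
  then have "mset (permute_list \<pi> y) = mset a" by (simp add: y)
  moreover have "sorted_wrt (\<ge>) (permute_list \<pi> y)"
    using step by (subst sorted_wrt_iff_nth_Suc_transp)
      (auto simp: transp_def permute_list_def len \<pi>_def m_def)
  ultimately have a_eq: "a = permute_list \<pi> y"
    using a by (intro sorted_wrt_ge_mset_unique) auto
  show ?thesis
  proof (rule nth_equalityI)
    show "length y = length (greedy a)" by (simp add: length_greedy len m_def)
    fix i assume "i < length y"
    then have i: "i < m" by (simp add: len)
    then have "greedy a ! i = a ! rank m i" by (simp add: greedy_nth m_def)
    also have "\<dots> = permute_list \<pi> y ! rank m i" by (subst a_eq) simp
    also have "\<dots> = y ! i"
      using i rank_less[OF i] by (simp add: permute_list_def len \<pi>_def position_rank)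
    finally show "y ! i = greedy a ! i" by simp
  qed
qed

text \<open>Provides the weight condition of \<open>sum_polarize_less\<close>. For
  \<open>c = 0\<close> the far side is \<open>0 < 2 * i < m\<close>, for \<open>c = m - 1\<close> it
  is \<open>2 * i > m - 1\<close>; in both cases a far position has rank one more than its mirror
  image.\<close>

lemma reflect_rank_le:
  assumes c: "c = 0 \<or> c = int m - 1" and i: "i \<in> {0..<int m}" and "\<not> far (int m) c i"
  shows "rank m (nat i) \<le> rank m (nat (reflect (int m) c i))"
  using c
proof
  assume c: "c = 0"
  have "i = 0 \<or> 2 * i \<ge> int m"
    using assms(3) i c by (auto simp: far_def)
  moreover have "reflect (int m) c i = (if i = 0 then 0 else int m - i)"
    using i c by (auto simp: reflect_def zmod_zminus1_eq_if)
  ultimately show ?thesis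
    using i by (auto simp: rank_def nat_diff_distrib)
next
  assume c: "c = int m - 1"
  have "2 * i \<le> int m - 1"
  proof (rule ccontr)
    assume "\<not> 2 * i \<le> int m - 1"
    moreover from this have "(2 * i - c) mod (2 * int m) = 2 * i - c"
      using i c by (intro mod_pos_pos_trivial) auto
    ultimately show False using assms(3) i c by (simp add: far_def)
  qed
  moreover have "reflect (int m) c i = int m - 1 - i"
    using i c by (auto simp: reflect_def)
  ultimately show ?thesis
    using i by (auto simp: rank_def)
qed

text \<open>The map \<open>i \<mapsto> m - 1 - i\<close> takes \<open>s\<close> to
  \<open>m - 1 - s\<close>, that is rank \<open>2 * s\<close> to \<open>2 * s + 1\<close>; negation
  takes \<open>m - 1 - s\<close> to \<open>s + 1\<close>, of rank \<open>2 * s + 2\<close>.\<close>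

lemma reflect_position:
  assumes "Suc t < m"
  shows "nat (reflect (int m) (if even t then int m - 1 else 0) (int (position m t))) =
    position m (Suc t)"
proof (cases "even t")
  case True
  then obtain s where "t = 2 * s" ..
  then show ?thesis using assms by (auto simp: reflect_def position_def)
next
  case False
  then obtain s where s: "t = 2 * s + 1" by (rule oddE)
  have "(- int (m - 1 - s)) mod int m = int (Suc s)"
    using assms s by (auto simp: zmod_zminus1_eq_if of_nat_diff)
  then show ?thesis using assms s by (simp add: reflect_def position_def)
qed

theorem theorem1p1:
  fixes m r :: nat and a z :: "real list"
  assumes "m \<ge> 2"
    and "length a = m"
    and "sorted_wrt (\<ge>) a"
    and "\<forall>x\<in>set a. x > 0"
    and "r \<in> {1..m}"
    and "circular_arrangement a z"
  shows "P r (greedy a) \<ge> P r z"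
proof -
  define S where "S = {y. mset y = mset a \<and> P r z \<le> P r y}"
  \<comment> \<open>Weights growing with the rank make a minimizer put large values at low
    ranks.\<close>
  define w where "w i = real (rank m (nat i))" for i
  define F where "F y = (\<Sum>i\<in>{0..<int m}. w i * y ! nat i)" for y
  have "S \<subseteq> {y. set y \<subseteq> set a \<and> length y = length a}"
    by (auto simp: S_def dest: mset_eq_setD mset_eq_length)
  then have "finite S" by (rule finite_subset) (simp add: finite_lists_length_eq)
  moreover have "z \<in> S"
    using assms(6) by (simp add: S_def circular_arrangement_def)
  ultimately obtain y where y: "y \<in> S" and min: "\<And>x. x \<in> S \<Longrightarrow> F y \<le> F x"
    by (metis arg_min_if_finite(1) arg_min_least empty_iff)
  have my: "mset y = mset a" using y by (simp add: S_def)
  have len: "length y = m" using my assms(2) by (metis size_mset)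
  have "y \<noteq> []" using len assms(1) by auto
  moreover have "set y = set a" using my by (metis set_mset_mset)
  ultimately have polar: "polarize_list c y \<in> S" for c
    using y P_polarize_list[of y r c] assms(1,4,5) len
    by (auto simp: S_def mset_polarize_list)
  have "y = greedy a"
  proof (rule greedy_unique[OF assms(3) my], rule ccontr)
    fix t assume "Suc t < length a"
    then have t: "Suc t < m" using assms(2) by simp
    assume "\<not> y ! position (length a) (Suc t) \<le> y ! position (length a) t"
    then have less: "y ! position m t < y ! position m (Suc t)" using assms(2) by simp
    \<comment> \<open>The reflection that exchanges ranks \<open>t\<close> and \<open>Suc t\<close>,
      whose values are out of order; polarizing by it stays in \<open>S\<close> and lowers
      \<open>F\<close>.\<close>
    define c where "c = (if even t then int m - 1 else 0)"
    define i where "i = int (position m t)"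
    have i: "i \<in> {0..<int m}" using t by (simp add: i_def position_less)
    have refl: "nat (reflect (int m) c i) = position m (Suc t)"
      unfolding c_def i_def by (rule reflect_position[OF t])
    have "F (polarize_list c y) =
        (\<Sum>i\<in>{0..<int m}. w i * polarize (int m) c (\<lambda>i. y ! nat i) i)"
      unfolding F_def using nth_polarize_list[of _ y c] len by (intro sum.cong) simp_all
    also have "\<dots> < F y"
      unfolding F_def
    proof (rule sum_polarize_less)
      show "w i < w (reflect (int m) c i)"
        using t by (simp add: w_def refl) (simp add: i_def rank_position)
      show "y ! nat i < y ! nat (reflect (int m) c i)"
        using less by (simp add: refl) (simp add: i_def)
    qed (use i assms(1) reflect_rank_le[of c m] in \<open>auto simp: w_def c_def\<close>)
    finally show False using min[OF polar, of c] by simp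
  qed
  then show ?thesis using y by (simp add: S_def)
qed

end
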